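(* Let $\Gamma$ be a set and let $\mathcal{U}$ be a unital operator space acting on $\ell^2(\Gamma)$ (i.e. a norm-closed unital subspace of $B(\ell^2(\Gamma))$) that contains the masa $\ell^\infty(\Gamma)$. Then $C^*_e(\mathcal{U})\cong C^*(\mathcal{U})$.
   Context: A subspace of $B(\mathcal{H})$ is unital if it contains the identity operator. For a set $\Gamma$, $\ell^2(\Gamma)$ is the Hilbert space of square-summable functions $\Gamma\to\mathbb{C}$, and $\ell^\infty(\Gamma)$ is identified with the algebra of multiplication operators $M_f\in B(\ell^2(\Gamma))$, $M_f(g)=fg$, for bounded $f:\Gamma\to\mathbb{C}$; it is a masa (maximal abelian self-adjoint subalgebra) of $B(\ell^2(\Gamma))$. $C^*(\mathcal{U})$ is the $C^*$-subalgebra of $B(\ell^2(\Gamma))$ generated by $\mathcal{U}$, and $\cong$ denotes $*$-isomorphism. $C^*$-envelope: a closed two-sided ideal $J$ of $C^*(\mathcal{U})$ is a boundary ideal for $\mathcal{U}$ if the restriction to $\mathcal{U}$ of the quotient map $C^*(\mathcal{U})\to C^*(\mathcal{U})/J$ is a complete isometry. For unital $\mathcal{U}$ there is a largest boundary ideal $J$ (the Shilov boundary of $\mathcal{U}$), and the $C^*$-envelope $C^*_e(\mathcal{U})$ is (up to $*$-isomorphism) $C^*(\mathcal{U})/J$ for this largest $J$. *)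

theory Defs
  imports
    "HOL-Analysis.Analysis"
    "HOL-Library.Function_Algebras"
    "HOL-Algebra.QuotRing"
    "HOL-Algebra.Module"
begin

section \<open>The Hilbert space of square-summable functions\<close>

text \<open>The index set is an arbitrary, possibly empty set \<open>\<Gamma>\<close>. A function \<open>\<Gamma> \<rightarrow> \<complex>\<close> is
  represented by its extension by zero to the whole type. Addition, subtraction, zero and
  finite sums of functions and of operators, and the product of two functions, are the pointwise
  ones of \<^theory>\<open>HOL-Library.Function_Algebras\<close>.\<close>

definition ell2 :: "'a set \<Rightarrow> ('a \<Rightarrow> complex) set" where
  "ell2 \<Gamma> = {x. (\<forall>g. g \<notin> \<Gamma> \<longrightarrow> x g = 0) \<and> (\<lambda>g. (cmod (x g))\<^sup>2) summable_on \<Gamma>}"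

definition ell2_inner :: "'a set \<Rightarrow> ('a \<Rightarrow> complex) \<Rightarrow> ('a \<Rightarrow> complex) \<Rightarrow> complex" where
  "ell2_inner \<Gamma> x y = (\<Sum>\<^sub>\<infinity>g\<in>\<Gamma>. x g * cnj (y g))"

definition ell2_norm :: "'a set \<Rightarrow> ('a \<Rightarrow> complex) \<Rightarrow> real" where
  "ell2_norm \<Gamma> x = sqrt (\<Sum>\<^sub>\<infinity>g\<in>\<Gamma>. (cmod (x g))\<^sup>2)"

definition scale_fun :: "complex \<Rightarrow> ('a \<Rightarrow> complex) \<Rightarrow> ('a \<Rightarrow> complex)" where
  "scale_fun c x = (\<lambda>g. c * x g)"


section \<open>Bounded operators\<close>

type_synonym 'a operator = "('a \<Rightarrow> complex) \<Rightarrow> ('a \<Rightarrow> complex)"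

text \<open>Operators take the value \<open>0\<close> outside of \<^term>\<open>ell2 \<Gamma>\<close>, so that equality of elements of
  \<open>bounded_ops \<Gamma>\<close> is equality of operators on \<^term>\<open>ell2 \<Gamma>\<close>.\<close>

definition bounded_ops :: "'a set \<Rightarrow> 'a operator set" where
  "bounded_ops \<Gamma> = {T.
     (\<forall>x\<in>ell2 \<Gamma>. T x \<in> ell2 \<Gamma>) \<and>
     (\<forall>x\<in>ell2 \<Gamma>. \<forall>y\<in>ell2 \<Gamma>. T (x + y) = T x + T y) \<and>
     (\<forall>c. \<forall>x\<in>ell2 \<Gamma>. T (scale_fun c x) = scale_fun c (T x)) \<and>
     (\<exists>K. \<forall>x\<in>ell2 \<Gamma>. ell2_norm \<Gamma> (T x) \<le> K * ell2_norm \<Gamma> x) \<and>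
     (\<forall>x. x \<notin> ell2 \<Gamma> \<longrightarrow> T x = 0)}"

definition op_id :: "'a set \<Rightarrow> 'a operator" where
  "op_id \<Gamma> = (\<lambda>x. if x \<in> ell2 \<Gamma> then x else 0)"

definition op_scale :: "complex \<Rightarrow> 'a operator \<Rightarrow> 'a operator" where
  "op_scale c T = (\<lambda>x. scale_fun c (T x))"

definition op_adjoint :: "'a set \<Rightarrow> 'a operator \<Rightarrow> 'a operator" where
  "op_adjoint \<Gamma> T = (THE S. S \<in> bounded_ops \<Gamma> \<and>
     (\<forall>x\<in>ell2 \<Gamma>. \<forall>y\<in>ell2 \<Gamma>. ell2_inner \<Gamma> (T x) y = ell2_inner \<Gamma> x (S y)))"

definition op_norm :: "'a set \<Rightarrow> 'a operator \<Rightarrow> real" where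
  "op_norm \<Gamma> T = (SUP x\<in>{x \<in> ell2 \<Gamma>. ell2_norm \<Gamma> x \<le> 1}. ell2_norm \<Gamma> (T x))"

definition mult_op :: "'a set \<Rightarrow> ('a \<Rightarrow> complex) \<Rightarrow> 'a operator" where
  "mult_op \<Gamma> f = (\<lambda>x. if x \<in> ell2 \<Gamma> then f * x else 0)"

definition ell_infty :: "'a set \<Rightarrow> 'a operator set" where
  "ell_infty \<Gamma> = {mult_op \<Gamma> f | f. bounded (f ` \<Gamma>)}"

definition norm_closed :: "'a set \<Rightarrow> 'a operator set \<Rightarrow> bool" where
  "norm_closed \<Gamma> A \<longleftrightarrow> (\<forall>S T. (\<forall>n::nat. S n \<in> A) \<and> T \<in> bounded_ops \<Gamma> \<and>
     (\<lambda>n. op_norm \<Gamma> (S n - T)) \<longlonglongrightarrow> 0 \<longrightarrow> T \<in> A)"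

definition op_subspace :: "'a operator set \<Rightarrow> bool" where
  "op_subspace A \<longleftrightarrow> 0 \<in> A \<and> (\<forall>S\<in>A. \<forall>T\<in>A. S + T \<in> A) \<and> (\<forall>c. \<forall>T\<in>A. op_scale c T \<in> A)"

definition unital_operator_space :: "'a set \<Rightarrow> 'a operator set \<Rightarrow> bool" where
  "unital_operator_space \<Gamma> U \<longleftrightarrow>
     U \<subseteq> bounded_ops \<Gamma> \<and> op_subspace U \<and> norm_closed \<Gamma> U \<and> op_id \<Gamma> \<in> U"


section \<open>Generated C*-algebras, quotients and *-isomorphism\<close>

record 'b star_algebra = "(complex, 'b) module" +
  star :: "'b \<Rightarrow> 'b"

definition cstar_subalgebra :: "'a set \<Rightarrow> 'a operator set \<Rightarrow> bool" where
  "cstar_subalgebra \<Gamma> A \<longleftrightarrow>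
     A \<subseteq> bounded_ops \<Gamma> \<and> op_subspace A \<and> norm_closed \<Gamma> A \<and>
     (\<forall>S\<in>A. \<forall>T\<in>A. S \<circ> T \<in> A) \<and> (\<forall>T\<in>A. op_adjoint \<Gamma> T \<in> A)"

text \<open>The unit of the record is the identity operator; the set generated by a unital operator
  space contains it.\<close>

definition cstar_gen :: "'a set \<Rightarrow> 'a operator set \<Rightarrow> 'a operator star_algebra" where
  "cstar_gen \<Gamma> U =
     \<lparr>carrier = \<Inter>{A. cstar_subalgebra \<Gamma> A \<and> U \<subseteq> A},
      monoid.mult = (\<lambda>S T. S \<circ> T), one = op_id \<Gamma>,
      zero = 0, add = (\<lambda>S T. S + T),
      smult = op_scale, star = op_adjoint \<Gamma>\<rparr>"

text \<open>The quotient ring with the induced scalar multiplication \<open>c(x + J) = cx + J\<close> and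
  involution \<open>(x + J)* = x* + J\<close>, written in the style of \<^const>\<open>rcoset_mult\<close>.\<close>

definition star_quot :: "'b star_algebra \<Rightarrow> 'b set \<Rightarrow> 'b set star_algebra" where
  "star_quot A J =
     \<lparr>carrier = carrier (A Quot J),
      monoid.mult = monoid.mult (A Quot J), one = one (A Quot J),
      zero = zero (A Quot J), add = add (A Quot J),
      smult = (\<lambda>c X. \<Union>x\<in>X. J +>\<^bsub>A\<^esub> (c \<odot>\<^bsub>A\<^esub> x)),
      star = (\<lambda>X. \<Union>x\<in>X. J +>\<^bsub>A\<^esub> (star A x))\<rparr>"

definition star_isomorphic :: "'b star_algebra \<Rightarrow> 'c star_algebra \<Rightarrow> bool" where
  "star_isomorphic A B \<longleftrightarrow> (\<exists>h \<in> ring_iso A B.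
     (\<forall>c. \<forall>x\<in>carrier A. h (c \<odot>\<^bsub>A\<^esub> x) = c \<odot>\<^bsub>B\<^esub> h x) \<and>
     (\<forall>x\<in>carrier A. h (star A x) = star B (h x)))"


section \<open>Matrix norms and complete isometries\<close>

text \<open>The entries \<open>M i j\<close> with \<open>i, j < n\<close> form an \<open>n \<times> n\<close> matrix; other entries are ignored.
  Its norm is that of the operator it induces on the \<open>n\<close>-fold Hilbert space direct sum of
  \<^term>\<open>ell2 \<Gamma>\<close>.\<close>

definition mat_norm :: "'a set \<Rightarrow> nat \<Rightarrow> (nat \<Rightarrow> nat \<Rightarrow> 'a operator) \<Rightarrow> real" where
  "mat_norm \<Gamma> n M =
     (SUP x\<in>{x. (\<forall>j<n. x j \<in> ell2 \<Gamma>) \<and> sqrt (\<Sum>j<n. (ell2_norm \<Gamma> (x j))\<^sup>2) \<le> 1}.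
        sqrt (\<Sum>i<n. (ell2_norm \<Gamma> (\<Sum>j<n. M i j (x j)))\<^sup>2))"

text \<open>The C*-norm of \<open>M\<^sub>n(A/J)\<close>, which is the quotient norm of \<open>M\<^sub>n(A)/M\<^sub>n(J)\<close>. The entries of
  \<open>X\<close> are cosets of \<open>J\<close>, so the infimum is over all representatives in \<open>M\<^sub>n(A)\<close>.\<close>

definition quot_mat_norm :: "'a set \<Rightarrow> nat \<Rightarrow> (nat \<Rightarrow> nat \<Rightarrow> 'a operator set) \<Rightarrow> real" where
  "quot_mat_norm \<Gamma> n X = (INF M\<in>{M. \<forall>i<n. \<forall>j<n. M i j \<in> X i j}. mat_norm \<Gamma> n M)"

definition complete_isometry_on ::
  "'b set \<Rightarrow> (nat \<Rightarrow> (nat \<Rightarrow> nat \<Rightarrow> 'b) \<Rightarrow> real) \<Rightarrow> (nat \<Rightarrow> (nat \<Rightarrow> nat \<Rightarrow> 'c) \<Rightarrow> real) \<Rightarrow>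
   ('b \<Rightarrow> 'c) \<Rightarrow> bool" where
  "complete_isometry_on U N N' \<phi> \<longleftrightarrow>
     (\<forall>n M. (\<forall>i<n. \<forall>j<n. M i j \<in> U) \<longrightarrow> N' n (\<lambda>i j. \<phi> (M i j)) = N n M)"


section \<open>The C*-envelope\<close>

definition boundary_ideal :: "'a set \<Rightarrow> 'a operator set \<Rightarrow> 'a operator set \<Rightarrow> bool" where
  "boundary_ideal \<Gamma> U J \<longleftrightarrow>
     ideal J (cstar_gen \<Gamma> U) \<and> norm_closed \<Gamma> J \<and>
     complete_isometry_on U (mat_norm \<Gamma>) (quot_mat_norm \<Gamma>) (\<lambda>T. J +>\<^bsub>cstar_gen \<Gamma> U\<^esub> T)"

definition shilov_boundary :: "'a set \<Rightarrow> 'a operator set \<Rightarrow> 'a operator set" where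
  "shilov_boundary \<Gamma> U = (GREATEST J. boundary_ideal \<Gamma> U J)"

definition cstar_envelope :: "'a set \<Rightarrow> 'a operator set \<Rightarrow> 'a operator set star_algebra" where
  "cstar_envelope \<Gamma> U = star_quot (cstar_gen \<Gamma> U) (shilov_boundary \<Gamma> U)"

end

theory Submission
  imports Defs
begin

text \<open>
  The Shilov boundary of \<open>U\<close> is zero, because the only boundary ideal is \<open>{0}\<close>, and then the
  quotient defining the C*-envelope is the C*-algebra generated by \<open>U\<close> itself.

  Let \<open>J\<close> be a boundary ideal containing an operator \<open>T \<noteq> 0\<close>. Some matrix entry
  \<open>c = \<langle>T \<delta>\<^sub>g, \<delta>\<^sub>h\<rangle>\<close> is nonzero. Let \<open>e\<^sub>g\<close> be the rank-one projection onto the line of the unit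
  vector \<open>\<delta>\<^sub>g\<close>. It is multiplication by the indicator function of \<open>{g}\<close>, so it lies in the masa and
  hence in \<open>U\<close>. The corner \<open>V = e\<^sub>h T e\<^sub>g\<close> belongs to \<open>J\<close>, and so does \<open>V\<^sup>* V = \<bar>c\<bar>\<^sup>2 e\<^sub>g\<close>;
  dividing by \<open>\<bar>c\<bar>\<^sup>2\<close>, which is again multiplication by an element of the masa, gives \<open>e\<^sub>g \<in> J\<close>
  (\<open>point_op_from_nonzero_entry\<close>). But \<open>e\<^sub>g\<close> is a nonzero element of \<open>U\<close>, and the quotient map is
  isometric on \<open>U\<close>, so \<open>e\<^sub>g\<close> cannot lie in \<open>J\<close> (\<open>boundary_ideal_avoids_point_op\<close>). Hence
  \<open>J = {0}\<close> (\<open>boundary_ideal_trivial\<close>). Conversely \<open>{0}\<close> is a boundary ideal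
  (\<open>boundary_ideal_zero\<close>).

  The remaining substance is that the bounded operators on the square-summable functions form a
  C*-algebra, which needs the existence of adjoints. These are obtained from the conjugate transpose
  of the matrix (\<open>adj_matrix_inner\<close>), using that \<open>\<langle>T x, y\<rangle>\<close> is the sum of \<open>x\<^sub>g \<langle>T \<delta>\<^sub>g, y\<rangle>\<close> over
  all \<open>g\<close> (\<open>bounded_ops_inner_has_sum\<close>).
\<close>


section \<open>Square-summable functions\<close>

text \<open>Norm bounds on square-summable functions are obtained from bounds on all finite subsets of
  the index set, where the inequalities for \<^const>\<open>L2_set\<close> apply.\<close>

lemma ell2_norm_nonneg [simp]: "0 \<le> ell2_norm \<Gamma> x"
  unfolding ell2_norm_def by (simp add: infsum_nonneg)

lemma L2_set_le_ell2_norm: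
  assumes "x \<in> ell2 \<Gamma>" "finite F" "F \<subseteq> \<Gamma>"
  shows "L2_set (\<lambda>g. cmod (x g)) F \<le> ell2_norm \<Gamma> x"
  unfolding L2_set_def ell2_norm_def
  using assms by (auto intro!: finite_sum_le_infsum simp: ell2_def)

lemma
  assumes "\<And>g. g \<notin> \<Gamma> \<Longrightarrow> x g = 0"
    and bound: "\<And>F. finite F \<Longrightarrow> F \<subseteq> \<Gamma> \<Longrightarrow> L2_set (\<lambda>g. cmod (x g)) F \<le> b"
  shows ell2_of_L2_set_bound: "x \<in> ell2 \<Gamma>"
    and ell2_norm_le_of_L2_set_bound: "ell2_norm \<Gamma> x \<le> b"
proof -
  have b: "0 \<le> b" using bound[of "{}"] by simp
  have fin: "(\<Sum>g\<in>F. (cmod (x g))\<^sup>2) \<le> b\<^sup>2" if "finite F" "F \<subseteq> \<Gamma>" for F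
    using bound[OF that] real_sqrt_le_iff[of "\<Sum>g\<in>F. (cmod (x g))\<^sup>2" "b\<^sup>2"] b
    unfolding L2_set_def by simp
  have summable: "(\<lambda>g. (cmod (x g))\<^sup>2) summable_on \<Gamma>"
    by (rule nonneg_bdd_above_summable_on) (auto intro!: bdd_aboveI2[where M = "b\<^sup>2"] fin)
  then show "x \<in> ell2 \<Gamma>" using assms(1) by (simp add: ell2_def)
  have "(\<Sum>\<^sub>\<infinity>g\<in>\<Gamma>. (cmod (x g))\<^sup>2) \<le> b\<^sup>2"
    by (rule infsum_le_finite_sums[OF summable fin])
  then show "ell2_norm \<Gamma> x \<le> b"
    unfolding ell2_norm_def using b real_le_lsqrt by (simp add: infsum_nonneg)
qed

lemma
  assumes "x \<in> ell2 \<Gamma>" "y \<in> ell2 \<Gamma>"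
  shows ell2_add: "x + y \<in> ell2 \<Gamma>"
    and ell2_norm_triangle: "ell2_norm \<Gamma> (x + y) \<le> ell2_norm \<Gamma> x + ell2_norm \<Gamma> y"
proof -
  have bound: "L2_set (\<lambda>g. cmod ((x + y) g)) F \<le> ell2_norm \<Gamma> x + ell2_norm \<Gamma> y"
    if F: "finite F" "F \<subseteq> \<Gamma>" for F
  proof -
    have "L2_set (\<lambda>g. cmod ((x + y) g)) F \<le> L2_set (\<lambda>g. cmod (x g) + cmod (y g)) F"
      by (rule L2_set_mono) (auto simp: norm_triangle_ineq)
    also have "\<dots> \<le> L2_set (\<lambda>g. cmod (x g)) F + L2_set (\<lambda>g. cmod (y g)) F"
      by (rule L2_set_triangle_ineq)
    also have "\<dots> \<le> ell2_norm \<Gamma> x + ell2_norm \<Gamma> y"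
      by (intro add_mono L2_set_le_ell2_norm assms F)
    finally show ?thesis .
  qed
  have zero: "(x + y) g = 0" if "g \<notin> \<Gamma>" for g
    using assms that by (simp add: ell2_def)
  show "x + y \<in> ell2 \<Gamma>" by (rule ell2_of_L2_set_bound[OF zero bound])
  show "ell2_norm \<Gamma> (x + y) \<le> ell2_norm \<Gamma> x + ell2_norm \<Gamma> y"
    by (rule ell2_norm_le_of_L2_set_bound[OF zero bound])
qed

text \<open>One estimate covers multiplication by a bounded function, and with it scalar multiples and
  restrictions to subsets.\<close>

lemma
  assumes x: "x \<in> ell2 \<Gamma>" and f: "\<And>g. g \<in> \<Gamma> \<Longrightarrow> cmod (f g) \<le> K" and K: "0 \<le> K"
  shows ell2_bounded_mult: "f * x \<in> ell2 \<Gamma>"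
    and ell2_norm_bounded_mult: "ell2_norm \<Gamma> (f * x) \<le> K * ell2_norm \<Gamma> x"
proof -
  have bound: "L2_set (\<lambda>g. cmod ((f * x) g)) F \<le> K * ell2_norm \<Gamma> x"
    if F: "finite F" "F \<subseteq> \<Gamma>" for F
  proof -
    have "L2_set (\<lambda>g. cmod ((f * x) g)) F \<le> L2_set (\<lambda>g. K * cmod (x g)) F"
      using F by (intro L2_set_mono) (auto simp: norm_mult intro!: mult_right_mono f)
    also have "\<dots> = K * L2_set (\<lambda>g. cmod (x g)) F"
      by (simp add: L2_set_right_distrib K)
    also have "\<dots> \<le> K * ell2_norm \<Gamma> x"
      by (intro mult_left_mono L2_set_le_ell2_norm x F K)
    finally show ?thesis .
  qed
  have zero: "(f * x) g = 0" if "g \<notin> \<Gamma>" for g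
    using x that by (simp add: ell2_def)
  show "f * x \<in> ell2 \<Gamma>" by (rule ell2_of_L2_set_bound[OF zero bound])
  show "ell2_norm \<Gamma> (f * x) \<le> K * ell2_norm \<Gamma> x"
    by (rule ell2_norm_le_of_L2_set_bound[OF zero bound])
qed

lemma scale_fun_eq_times: "scale_fun c x = (\<lambda>_. c) * x"
  by (simp add: scale_fun_def fun_eq_iff)

lemma scale_fun_apply [simp]: "scale_fun c x g = c * x g"
  by (simp add: scale_fun_def)

lemma ell2_scale: "x \<in> ell2 \<Gamma> \<Longrightarrow> scale_fun c x \<in> ell2 \<Gamma>"
  unfolding scale_fun_eq_times by (rule ell2_bounded_mult[where K = "cmod c"]) auto

lemma ell2_norm_scale_le: "x \<in> ell2 \<Gamma> \<Longrightarrow> ell2_norm \<Gamma> (scale_fun c x) \<le> cmod c * ell2_norm \<Gamma> x"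
  unfolding scale_fun_eq_times by (rule ell2_norm_bounded_mult) auto

lemma zero_in_ell2 [simp]: "0 \<in> ell2 \<Gamma>"
  by (simp add: ell2_def)

lemma ell2_norm_zero [simp]: "ell2_norm \<Gamma> 0 = 0"
  by (simp add: ell2_norm_def)

lemma ell2_norm_eq_zero:
  assumes "x \<in> ell2 \<Gamma>" "ell2_norm \<Gamma> x = 0"
  shows "x = 0"
proof
  fix g show "x g = 0 g"
    using L2_set_le_ell2_norm[OF assms(1), of "{g}"] assms by (cases "g \<in> \<Gamma>") (auto simp: ell2_def)
qed

definition ell2_unit :: "'a \<Rightarrow> 'a \<Rightarrow> complex" where
  "ell2_unit g = (\<lambda>k. if k = g then 1 else 0)"

lemma ell2_unit_apply [simp]: "ell2_unit g k = (if k = g then 1 else 0)"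
  by (simp add: ell2_unit_def)

lemma
  assumes "g \<in> \<Gamma>"
  shows ell2_unit_in_ell2: "ell2_unit g \<in> ell2 \<Gamma>"
    and ell2_norm_unit: "ell2_norm \<Gamma> (ell2_unit g) = 1"
proof -
  have "((\<lambda>k. (cmod (ell2_unit g k))\<^sup>2) has_sum 1) {g}"
    using has_sum_finite[of "{g}" "\<lambda>k. (cmod (ell2_unit g k))\<^sup>2"] by simp
  then have "((\<lambda>k. (cmod (ell2_unit g k))\<^sup>2) has_sum 1) \<Gamma>"
    by (rule has_sum_cong_neutral[THEN iffD1, rotated -1]) (use assms in auto)
  then show "ell2_unit g \<in> ell2 \<Gamma>" "ell2_norm \<Gamma> (ell2_unit g) = 1"
    using assms by (auto simp: ell2_def ell2_norm_def infsumI intro: has_sum_imp_summable)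
qed


section \<open>The inner product\<close>

lemma
  assumes x: "x \<in> ell2 \<Gamma>" and y: "y \<in> ell2 \<Gamma>"
  shows ell2_inner_summable: "(\<lambda>g. x g * cnj (y g)) summable_on \<Gamma>"
    and ell2_Cauchy_Schwarz: "cmod (ell2_inner \<Gamma> x y) \<le> ell2_norm \<Gamma> x * ell2_norm \<Gamma> y"
proof -
  have fin: "(\<Sum>g\<in>F. cmod (x g * cnj (y g))) \<le> ell2_norm \<Gamma> x * ell2_norm \<Gamma> y"
    if F: "finite F" "F \<subseteq> \<Gamma>" for F
  proof -
    have "(\<Sum>g\<in>F. cmod (x g * cnj (y g))) = (\<Sum>g\<in>F. \<bar>cmod (x g)\<bar> * \<bar>cmod (y g)\<bar>)"
      by (simp add: norm_mult)
    also have "\<dots> \<le> L2_set (\<lambda>g. cmod (x g)) F * L2_set (\<lambda>g. cmod (y g)) F"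
      by (rule L2_set_mult_ineq)
    also have "\<dots> \<le> ell2_norm \<Gamma> x * ell2_norm \<Gamma> y"
      by (intro mult_mono L2_set_le_ell2_norm x y F) auto
    finally show ?thesis .
  qed
  have summable: "(\<lambda>g. cmod (x g * cnj (y g))) summable_on \<Gamma>"
    by (rule nonneg_bdd_above_summable_on)
      (auto intro!: bdd_aboveI2[where M = "ell2_norm \<Gamma> x * ell2_norm \<Gamma> y"] fin)
  then show "(\<lambda>g. x g * cnj (y g)) summable_on \<Gamma>"
    by (rule abs_summable_summable)
  have "cmod (ell2_inner \<Gamma> x y) \<le> (\<Sum>\<^sub>\<infinity>g\<in>\<Gamma>. cmod (x g * cnj (y g)))"
    unfolding ell2_inner_def by (rule norm_infsum_bound[OF summable])
  also have "\<dots> \<le> ell2_norm \<Gamma> x * ell2_norm \<Gamma> y"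
    by (rule infsum_le_finite_sums[OF summable fin])
  finally show "cmod (ell2_inner \<Gamma> x y) \<le> ell2_norm \<Gamma> x * ell2_norm \<Gamma> y" .
qed

lemma ell2_inner_add_left:
  assumes "x \<in> ell2 \<Gamma>" "x' \<in> ell2 \<Gamma>" "y \<in> ell2 \<Gamma>"
  shows "ell2_inner \<Gamma> (x + x') y = ell2_inner \<Gamma> x y + ell2_inner \<Gamma> x' y"
  unfolding ell2_inner_def
  using infsum_add[OF ell2_inner_summable[OF assms(1,3)] ell2_inner_summable[OF assms(2,3)]]
  by (simp add: distrib_right)

lemma ell2_inner_scale_left: "ell2_inner \<Gamma> (scale_fun c x) y = c * ell2_inner \<Gamma> x y"
  unfolding ell2_inner_def by (simp add: mult.assoc infsum_cmult_right')

lemma ell2_inner_zero_left [simp]: "ell2_inner \<Gamma> 0 y = 0"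
  unfolding ell2_inner_def by simp

lemma ell2_inner_commute: "ell2_inner \<Gamma> x y = cnj (ell2_inner \<Gamma> y x)"
  unfolding ell2_inner_def by (simp add: mult.commute flip: infsum_cnj)

lemma ell2_inner_unit_right:
  assumes "g \<in> \<Gamma>"
  shows "ell2_inner \<Gamma> x (ell2_unit g) = x g"
proof -
  have "ell2_inner \<Gamma> x (ell2_unit g) = (\<Sum>\<^sub>\<infinity>k\<in>{g}. x k)"
    unfolding ell2_inner_def using assms by (intro infsum_cong_neutral) auto
  then show ?thesis by simp
qed

lemma ell2_inner_unit_left: "g \<in> \<Gamma> \<Longrightarrow> ell2_inner \<Gamma> (ell2_unit g) x = cnj (x g)"
  by (subst ell2_inner_commute) (simp add: ell2_inner_unit_right)


section \<open>Finitely supported vectors are dense\<close>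

definition restr :: "'a set \<Rightarrow> ('a \<Rightarrow> complex) \<Rightarrow> 'a \<Rightarrow> complex" where
  "restr F x = (\<lambda>k. if k \<in> F then x k else 0)"

lemma restr_eq_times: "restr F x = (\<lambda>k. of_bool (k \<in> F)) * x"
  by (simp add: restr_def fun_eq_iff)

lemma restr_in_ell2: "x \<in> ell2 \<Gamma> \<Longrightarrow> restr F x \<in> ell2 \<Gamma>"
  unfolding restr_eq_times by (rule ell2_bounded_mult[where K = 1]) auto

lemma restr_empty: "restr {} x = 0"
  by (simp add: restr_def fun_eq_iff)

lemma restr_insert:
  "g \<notin> F \<Longrightarrow> restr (insert g F) x = restr F x + scale_fun (x g) (ell2_unit g)"
  by (auto simp: restr_def fun_eq_iff)

lemma restr_split: "x = restr F x + restr (- F) x"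
  by (auto simp: restr_def fun_eq_iff)

lemma ell2_norm_restr_finite:
  assumes "finite F" "F \<subseteq> \<Gamma>"
  shows "ell2_norm \<Gamma> (restr F x) = L2_set (\<lambda>g. cmod (x g)) F"
proof -
  have "(\<Sum>\<^sub>\<infinity>g\<in>\<Gamma>. (cmod (restr F x g))\<^sup>2) = (\<Sum>\<^sub>\<infinity>g\<in>F. (cmod (x g))\<^sup>2)"
    using assms by (intro infsum_cong_neutral) (auto simp: restr_def)
  then show ?thesis
    using assms by (simp add: ell2_norm_def L2_set_def)
qed

lemma restr_in_ell2_finite:
  assumes "finite F" "F \<subseteq> \<Gamma>"
  shows "restr F x \<in> ell2 \<Gamma>"
  using assms
proof induction
  case empty
  show ?case by (simp only: restr_empty zero_in_ell2)
next
  case (insert g F)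
  then show ?case
    unfolding restr_insert[OF insert(2)] by (intro ell2_add ell2_scale ell2_unit_in_ell2) auto
qed

lemma ell2_tail_tendsto_zero:
  assumes x: "x \<in> ell2 \<Gamma>"
  shows "((\<lambda>F. ell2_norm \<Gamma> (restr (- F) x)) \<longlongrightarrow> 0) (finite_subsets_at_top \<Gamma>)"
proof -
  let ?f = "\<lambda>g. (cmod (x g))\<^sup>2"
  have summable: "?f summable_on \<Gamma>" using x by (simp add: ell2_def)
  have "((\<lambda>F. sqrt (infsum ?f \<Gamma> - sum ?f F)) \<longlongrightarrow> sqrt (infsum ?f \<Gamma> - infsum ?f \<Gamma>))
      (finite_subsets_at_top \<Gamma>)"
    by (intro tendsto_intros infsum_tendsto summable)
  moreover have "sqrt (infsum ?f \<Gamma> - sum ?f F) = ell2_norm \<Gamma> (restr (- F) x)"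
    if "finite F" "F \<subseteq> \<Gamma>" for F
  proof -
    have "(\<Sum>\<^sub>\<infinity>g\<in>\<Gamma>. (cmod (restr (- F) x g))\<^sup>2) = infsum ?f (\<Gamma> - F)"
      by (intro infsum_cong_neutral) (auto simp: restr_def)
    also have "\<dots> = infsum ?f \<Gamma> - infsum ?f F"
      using that by (intro infsum_Diff summable) auto
    finally show ?thesis using that by (simp add: ell2_norm_def)
  qed
  then have "\<forall>\<^sub>F F in finite_subsets_at_top \<Gamma>.
      sqrt (infsum ?f \<Gamma> - sum ?f F) = ell2_norm \<Gamma> (restr (- F) x)"
    by (auto simp: eventually_finite_subsets_at_top intro!: exI[of _ "{}"])
  ultimately show ?thesis
    using tendsto_cong by fastforce
qed


section \<open>Bounded operators form a C*-algebra\<close>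

lemma bounded_ops_bound:
  assumes "T \<in> bounded_ops \<Gamma>"
  obtains K where "0 \<le> K" "\<And>x. x \<in> ell2 \<Gamma> \<Longrightarrow> ell2_norm \<Gamma> (T x) \<le> K * ell2_norm \<Gamma> x"
proof -
  from assms obtain K where K: "\<And>x. x \<in> ell2 \<Gamma> \<Longrightarrow> ell2_norm \<Gamma> (T x) \<le> K * ell2_norm \<Gamma> x"
    unfolding bounded_ops_def by blast
  have "ell2_norm \<Gamma> (T x) \<le> \<bar>K\<bar> * ell2_norm \<Gamma> x" if "x \<in> ell2 \<Gamma>" for x
    using K[OF that] by (rule order_trans) (auto intro!: mult_right_mono)
  then show ?thesis by (intro that[of "\<bar>K\<bar>"]) auto
qed

lemma bounded_opsD:
  assumes "T \<in> bounded_ops \<Gamma>"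
  shows bounded_ops_closed: "x \<in> ell2 \<Gamma> \<Longrightarrow> T x \<in> ell2 \<Gamma>"
    and bounded_ops_add: "x \<in> ell2 \<Gamma> \<Longrightarrow> y \<in> ell2 \<Gamma> \<Longrightarrow> T (x + y) = T x + T y"
    and bounded_ops_scale: "x \<in> ell2 \<Gamma> \<Longrightarrow> T (scale_fun c x) = scale_fun c (T x)"
    and bounded_ops_outside: "x \<notin> ell2 \<Gamma> \<Longrightarrow> T x = 0"
  using assms by (auto simp: bounded_ops_def)

lemma bounded_ops_range: "T \<in> bounded_ops \<Gamma> \<Longrightarrow> T x \<in> ell2 \<Gamma>"
  using bounded_ops_closed bounded_ops_outside zero_in_ell2 by metis

lemma bounded_ops_zero: "T \<in> bounded_ops \<Gamma> \<Longrightarrow> T 0 = 0"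
  using bounded_ops_scale[of T \<Gamma> 0 0] by (simp add: scale_fun_eq_times fun_eq_iff)

lemma bounded_opsI:
  assumes "\<And>x. x \<in> ell2 \<Gamma> \<Longrightarrow> T x \<in> ell2 \<Gamma>"
    and "\<And>x y. x \<in> ell2 \<Gamma> \<Longrightarrow> y \<in> ell2 \<Gamma> \<Longrightarrow> T (x + y) = T x + T y"
    and "\<And>c x. x \<in> ell2 \<Gamma> \<Longrightarrow> T (scale_fun c x) = scale_fun c (T x)"
    and "\<And>x. x \<in> ell2 \<Gamma> \<Longrightarrow> ell2_norm \<Gamma> (T x) \<le> K * ell2_norm \<Gamma> x"
    and "\<And>x. x \<notin> ell2 \<Gamma> \<Longrightarrow> T x = 0"
  shows "T \<in> bounded_ops \<Gamma>"
  using assms unfolding bounded_ops_def by blast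

lemma zero_in_bounded_ops: "0 \<in> bounded_ops \<Gamma>"
  by (rule bounded_opsI[where K = 0]) (auto simp: fun_eq_iff)

lemma bounded_ops_plus:
  assumes S: "S \<in> bounded_ops \<Gamma>" and T: "T \<in> bounded_ops \<Gamma>"
  shows "S + T \<in> bounded_ops \<Gamma>"
proof -
  obtain K L where K: "\<And>x. x \<in> ell2 \<Gamma> \<Longrightarrow> ell2_norm \<Gamma> (S x) \<le> K * ell2_norm \<Gamma> x"
    and L: "\<And>x. x \<in> ell2 \<Gamma> \<Longrightarrow> ell2_norm \<Gamma> (T x) \<le> L * ell2_norm \<Gamma> x"
    using bounded_ops_bound S T by metis
  show ?thesis
  proof (rule bounded_opsI[where K = "K + L"])
    fix x assume x: "x \<in> ell2 \<Gamma>"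
    have "ell2_norm \<Gamma> (S x + T x) \<le> ell2_norm \<Gamma> (S x) + ell2_norm \<Gamma> (T x)"
      by (intro ell2_norm_triangle bounded_ops_closed[OF S] bounded_ops_closed[OF T] x)
    with K[OF x] L[OF x] show "ell2_norm \<Gamma> ((S + T) x) \<le> (K + L) * ell2_norm \<Gamma> x"
      by (simp add: distrib_right)
  qed (auto simp: ell2_add S T bounded_opsD[OF S] bounded_opsD[OF T] fun_eq_iff distrib_left)
qed

lemma bounded_ops_op_scale:
  assumes T: "T \<in> bounded_ops \<Gamma>"
  shows "op_scale c T \<in> bounded_ops \<Gamma>"
proof -
  obtain K where K: "\<And>x. x \<in> ell2 \<Gamma> \<Longrightarrow> ell2_norm \<Gamma> (T x) \<le> K * ell2_norm \<Gamma> x"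
    using bounded_ops_bound T by metis
  show ?thesis
    unfolding op_scale_def
  proof (rule bounded_opsI[where K = "cmod c * K"])
    fix x assume x: "x \<in> ell2 \<Gamma>"
    have "ell2_norm \<Gamma> (scale_fun c (T x)) \<le> cmod c * ell2_norm \<Gamma> (T x)"
      by (intro ell2_norm_scale_le bounded_ops_closed[OF T] x)
    also have "\<dots> \<le> cmod c * (K * ell2_norm \<Gamma> x)"
      by (intro mult_left_mono K x) auto
    finally show "ell2_norm \<Gamma> (scale_fun c (T x)) \<le> cmod c * K * ell2_norm \<Gamma> x"
      by (simp add: mult.assoc)
  qed (auto simp: ell2_scale bounded_opsD[OF T] fun_eq_iff distrib_left)
qed

lemma bounded_ops_comp:
  assumes S: "S \<in> bounded_ops \<Gamma>" and T: "T \<in> bounded_ops \<Gamma>"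
  shows "S \<circ> T \<in> bounded_ops \<Gamma>"
proof -
  obtain K L where K: "0 \<le> K" "\<And>x. x \<in> ell2 \<Gamma> \<Longrightarrow> ell2_norm \<Gamma> (S x) \<le> K * ell2_norm \<Gamma> x"
    and L: "\<And>x. x \<in> ell2 \<Gamma> \<Longrightarrow> ell2_norm \<Gamma> (T x) \<le> L * ell2_norm \<Gamma> x"
    using bounded_ops_bound S T by metis
  show ?thesis
  proof (rule bounded_opsI[where K = "K * L"])
    fix x assume x: "x \<in> ell2 \<Gamma>"
    have "ell2_norm \<Gamma> (S (T x)) \<le> K * ell2_norm \<Gamma> (T x)"
      by (intro K bounded_ops_closed[OF T] x)
    also have "\<dots> \<le> K * (L * ell2_norm \<Gamma> x)"
      by (intro mult_left_mono L K x)
    finally show "ell2_norm \<Gamma> ((S \<circ> T) x) \<le> K * L * ell2_norm \<Gamma> x"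
      by (simp add: mult.assoc)
  qed (auto simp: bounded_opsD[OF S] bounded_opsD[OF T] bounded_ops_zero[OF S])
qed

lemma bounded_ops_inner_restr:
  assumes T: "T \<in> bounded_ops \<Gamma>" and y: "y \<in> ell2 \<Gamma>" and F: "finite F" "F \<subseteq> \<Gamma>"
  shows "ell2_inner \<Gamma> (T (restr F x)) y = (\<Sum>g\<in>F. x g * ell2_inner \<Gamma> (T (ell2_unit g)) y)"
  using F
proof induction
  case empty
  show ?case by (simp only: restr_empty bounded_ops_zero[OF T] ell2_inner_zero_left sum.empty)
next
  case (insert g F)
  have r: "restr F x \<in> ell2 \<Gamma>" using insert by (intro restr_in_ell2_finite) auto
  have g: "ell2_unit g \<in> ell2 \<Gamma>" using insert by (intro ell2_unit_in_ell2) auto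
  have "ell2_inner \<Gamma> (T (restr (insert g F) x)) y
      = ell2_inner \<Gamma> (T (restr F x)) y + x g * ell2_inner \<Gamma> (T (ell2_unit g)) y"
    unfolding restr_insert[OF insert(2)] bounded_ops_add[OF T r ell2_scale[OF g]]
      bounded_ops_scale[OF T g]
    by (simp only: ell2_inner_add_left bounded_ops_closed[OF T] ell2_scale ell2_inner_scale_left
        r g y)
  with insert show ?case
    by (simp only: sum.insert[OF insert(1,2)] insert_subset add.commute simp_thms)
qed

text \<open>Splitting \<open>x\<close> into its restriction to a finite set and the remaining tail, the first part
  contributes exactly the finite partial sum, and the second is small because \<open>T\<close> is bounded and
  the tail of \<open>x\<close> is. This replaces the Riesz representation theorem in the construction of the
  adjoint, and shows that an operator is determined by its values on the unit vectors.\<close>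

lemma bounded_ops_inner_has_sum:
  assumes T: "T \<in> bounded_ops \<Gamma>" and x: "x \<in> ell2 \<Gamma>" and y: "y \<in> ell2 \<Gamma>"
  shows "((\<lambda>g. x g * ell2_inner \<Gamma> (T (ell2_unit g)) y) has_sum ell2_inner \<Gamma> (T x) y) \<Gamma>"
proof -
  obtain K where K: "0 \<le> K" "\<And>x. x \<in> ell2 \<Gamma> \<Longrightarrow> ell2_norm \<Gamma> (T x) \<le> K * ell2_norm \<Gamma> x"
    using bounded_ops_bound T by metis
  let ?s = "\<lambda>F. \<Sum>g\<in>F. x g * ell2_inner \<Gamma> (T (ell2_unit g)) y"
  have close: "dist (?s F) (ell2_inner \<Gamma> (T x) y)
      \<le> K * ell2_norm \<Gamma> (restr (- F) x) * ell2_norm \<Gamma> y" if F: "finite F" "F \<subseteq> \<Gamma>" for F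
  proof -
    note r = restr_in_ell2[OF x]
    have "ell2_inner \<Gamma> (T x) y
        = ell2_inner \<Gamma> (T (restr F x)) y + ell2_inner \<Gamma> (T (restr (- F) x)) y"
      by (subst restr_split[of x F])
        (simp add: bounded_ops_add[OF T] ell2_inner_add_left bounded_ops_closed[OF T] r y)
    then have "dist (?s F) (ell2_inner \<Gamma> (T x) y) = cmod (ell2_inner \<Gamma> (T (restr (- F) x)) y)"
      using bounded_ops_inner_restr[OF T y F] by (simp add: dist_norm)
    also have "\<dots> \<le> ell2_norm \<Gamma> (T (restr (- F) x)) * ell2_norm \<Gamma> y"
      by (intro ell2_Cauchy_Schwarz bounded_ops_closed[OF T] r y)
    also have "\<dots> \<le> K * ell2_norm \<Gamma> (restr (- F) x) * ell2_norm \<Gamma> y"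
      by (intro mult_right_mono K r) auto
    finally show ?thesis .
  qed
  have "((\<lambda>F. K * ell2_norm \<Gamma> (restr (- F) x) * ell2_norm \<Gamma> y) \<longlongrightarrow> K * 0 * ell2_norm \<Gamma> y)
      (finite_subsets_at_top \<Gamma>)"
    by (intro tendsto_intros ell2_tail_tendsto_zero x)
  then have lim: "((\<lambda>F. K * ell2_norm \<Gamma> (restr (- F) x) * ell2_norm \<Gamma> y) \<longlongrightarrow> 0)
      (finite_subsets_at_top \<Gamma>)"
    by simp
  show ?thesis
    unfolding has_sum_def
  proof (rule metric_tendsto_imp_tendsto[OF lim])
    show "\<forall>\<^sub>F F in finite_subsets_at_top \<Gamma>. dist (?s F) (ell2_inner \<Gamma> (T x) y)
        \<le> dist (K * ell2_norm \<Gamma> (restr (- F) x) * ell2_norm \<Gamma> y) 0"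
      using close K(1) by (auto simp: eventually_finite_subsets_at_top intro!: exI[of _ "{}"])
  qed
qed

lemma bounded_ops_eq_zero:
  assumes T: "T \<in> bounded_ops \<Gamma>" and "\<And>g. g \<in> \<Gamma> \<Longrightarrow> T (ell2_unit g) = 0"
  shows "T = 0"
proof
  fix x
  show "T x = 0 x"
  proof (cases "x \<in> ell2 \<Gamma>")
    case x: True
    have "T x h = 0" for h
    proof (cases "h \<in> \<Gamma>")
      case h: True
      have "((\<lambda>g. x g * ell2_inner \<Gamma> (T (ell2_unit g)) (ell2_unit h)) has_sum T x h) \<Gamma>"
        using bounded_ops_inner_has_sum[OF T x ell2_unit_in_ell2[OF h]]
        by (simp add: ell2_inner_unit_right[OF h])
      moreover have "((\<lambda>g. x g * ell2_inner \<Gamma> (T (ell2_unit g)) (ell2_unit h)) has_sum 0) \<Gamma>"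
        using assms(2) by (intro has_sum_0) simp
      ultimately show ?thesis using has_sum_unique by blast
    qed (use bounded_ops_closed[OF T x] in \<open>simp add: ell2_def\<close>)
    then show ?thesis by (simp add: fun_eq_iff)
  qed (simp add: bounded_ops_outside[OF T])
qed

text \<open>The adjoint given by the conjugate transpose of the matrix of \<open>T\<close>.\<close>

definition adj_matrix :: "'a set \<Rightarrow> 'a operator \<Rightarrow> 'a operator" where
  "adj_matrix \<Gamma> T =
     (\<lambda>y g. if y \<in> ell2 \<Gamma> \<and> g \<in> \<Gamma> then ell2_inner \<Gamma> y (T (ell2_unit g)) else 0)"

text \<open>Let \<open>S\<close> be the conjugate transpose of \<open>T\<close>, \<open>F\<close> a finite set and \<open>z\<close> the restriction of \<open>S y\<close> to
  \<open>F\<close>. Then \<open>\<parallel>z\<parallel>\<^sup>2 = \<langle>T z, y\<rangle> \<le> K \<parallel>z\<parallel> \<parallel>y\<parallel>\<close>, hence \<open>\<parallel>z\<parallel> \<le> K \<parallel>y\<parallel>\<close> for every \<open>F\<close>. So \<open>S y\<close> is square-summable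
  and \<open>S\<close> is bounded. The adjoint relation is the expansion of \<open>\<langle>T x, y\<rangle>\<close> in the coordinates of
  \<open>x\<close>.\<close>

lemma
  assumes T: "T \<in> bounded_ops \<Gamma>"
  shows adj_matrix_in_bounded_ops: "adj_matrix \<Gamma> T \<in> bounded_ops \<Gamma>"
    and adj_matrix_inner: "x \<in> ell2 \<Gamma> \<Longrightarrow> y \<in> ell2 \<Gamma> \<Longrightarrow>
      ell2_inner \<Gamma> (T x) y = ell2_inner \<Gamma> x (adj_matrix \<Gamma> T y)"
proof -
  obtain K where K: "0 \<le> K" "\<And>x. x \<in> ell2 \<Gamma> \<Longrightarrow> ell2_norm \<Gamma> (T x) \<le> K * ell2_norm \<Gamma> x"
    using bounded_ops_bound T by metis
  let ?S = "adj_matrix \<Gamma> T"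
  have entry: "cnj (?S y g) = ell2_inner \<Gamma> (T (ell2_unit g)) y" if "y \<in> ell2 \<Gamma>" "g \<in> \<Gamma>" for y g
    using that ell2_inner_commute[of \<Gamma> "T (ell2_unit g)" y] by (simp add: adj_matrix_def)
  have bound: "L2_set (\<lambda>g. cmod (?S y g)) F \<le> K * ell2_norm \<Gamma> y"
    if y: "y \<in> ell2 \<Gamma>" and F: "finite F" "F \<subseteq> \<Gamma>" for y F
  proof -
    let ?L = "L2_set (\<lambda>g. cmod (?S y g)) F"
    \<comment> \<open>\<open>?S y\<close> is not yet known to be square-summable, but its restriction to \<open>F\<close> is.\<close>
    let ?z = "restr F (?S y)"
    have z: "?z \<in> ell2 \<Gamma>" using F by (rule restr_in_ell2_finite)
    have "ell2_inner \<Gamma> (T ?z) y = (\<Sum>g\<in>F. ?S y g * cnj (?S y g))"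
      unfolding bounded_ops_inner_restr[OF T y F]
      using F y by (intro sum.cong) (auto simp: entry)
    also have "\<dots> = complex_of_real (?L\<^sup>2)"
      by (simp add: L2_set_def sum_nonneg flip: complex_norm_square)
    finally have "?L\<^sup>2 = cmod (ell2_inner \<Gamma> (T ?z) y)"
      by (simp only: norm_of_real abs_power2 flip: of_real_power)
    also have "\<dots> \<le> ell2_norm \<Gamma> (T ?z) * ell2_norm \<Gamma> y"
      by (intro ell2_Cauchy_Schwarz bounded_ops_closed[OF T] z y)
    also have "\<dots> \<le> K * ell2_norm \<Gamma> ?z * ell2_norm \<Gamma> y"
      by (intro mult_right_mono K z) auto
    also have "ell2_norm \<Gamma> ?z = ?L" using F by (rule ell2_norm_restr_finite)
    finally have "?L * ?L \<le> ?L * (K * ell2_norm \<Gamma> y)" by (simp add: power2_eq_square ac_simps)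
    then show ?thesis
      using K(1) by (cases "?L = 0") (auto simp: mult_le_cancel_left less_le)
  qed
  have zero: "?S y g = 0" if "g \<notin> \<Gamma>" for y g
    using that by (simp add: adj_matrix_def)
  have S: "?S y \<in> ell2 \<Gamma>" if "y \<in> ell2 \<Gamma>" for y
    using zero bound[OF that] by (rule ell2_of_L2_set_bound)
  show "?S \<in> bounded_ops \<Gamma>"
  proof (rule bounded_opsI[where K = K])
    show "ell2_norm \<Gamma> (?S y) \<le> K * ell2_norm \<Gamma> y" if "y \<in> ell2 \<Gamma>" for y
      using zero bound[OF that] by (rule ell2_norm_le_of_L2_set_bound)
    show "?S (x + y) = ?S x + ?S y" if "x \<in> ell2 \<Gamma>" "y \<in> ell2 \<Gamma>" for x y
      using that
      by (auto simp: adj_matrix_def fun_eq_iff ell2_add ell2_inner_add_left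
          bounded_ops_closed[OF T] ell2_unit_in_ell2)
    show "?S (scale_fun c y) = scale_fun c (?S y)" if "y \<in> ell2 \<Gamma>" for c y
      using that by (auto simp: adj_matrix_def fun_eq_iff ell2_scale ell2_inner_scale_left)
  qed (use S in \<open>auto simp: adj_matrix_def fun_eq_iff\<close>)
  show "ell2_inner \<Gamma> (T x) y = ell2_inner \<Gamma> x (?S y)" if x: "x \<in> ell2 \<Gamma>" and y: "y \<in> ell2 \<Gamma>"
  proof -
    have "((\<lambda>g. x g * cnj (?S y g)) has_sum ell2_inner \<Gamma> (T x) y) \<Gamma>"
      using bounded_ops_inner_has_sum[OF T x y] entry[OF y]
      by (simp cong: has_sum_cong)
    then show ?thesis unfolding ell2_inner_def[of \<Gamma> x] by (simp add: infsumI)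
  qed
qed

lemma op_adjoint_eq_adj_matrix:
  assumes T: "T \<in> bounded_ops \<Gamma>"
  shows "op_adjoint \<Gamma> T = adj_matrix \<Gamma> T"
  unfolding op_adjoint_def
proof (rule the_equality)
  fix S
  assume S: "S \<in> bounded_ops \<Gamma> \<and>
     (\<forall>x\<in>ell2 \<Gamma>. \<forall>y\<in>ell2 \<Gamma>. ell2_inner \<Gamma> (T x) y = ell2_inner \<Gamma> x (S y))"
  show "S = adj_matrix \<Gamma> T"
  proof (intro ext)
    fix y g
    show "S y g = adj_matrix \<Gamma> T y g"
    proof (cases "y \<in> ell2 \<Gamma> \<and> g \<in> \<Gamma>")
      case True
      then have "cnj (S y g) = ell2_inner \<Gamma> (ell2_unit g) (S y)"
        by (simp add: ell2_inner_unit_left)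
      also have "\<dots> = ell2_inner \<Gamma> (ell2_unit g) (adj_matrix \<Gamma> T y)"
        using S True adj_matrix_inner[OF T] ell2_unit_in_ell2 by metis
      also have "\<dots> = cnj (adj_matrix \<Gamma> T y g)"
        using True by (simp add: ell2_inner_unit_left)
      finally show ?thesis by simp
    next
      case False
      then have "S y g = 0"
        using S bounded_ops_range[of S \<Gamma> y] bounded_ops_outside[of S \<Gamma> y]
        by (cases "y \<in> ell2 \<Gamma>") (auto simp: ell2_def)
      then show ?thesis using False by (auto simp: adj_matrix_def)
    qed
  qed
qed (use adj_matrix_in_bounded_ops[OF T] adj_matrix_inner[OF T] in blast)

text \<open>This makes the family of C*-algebras containing a given set of bounded operators nonempty.
  An empty family would have as intersection the set of all maps, which is not a ring.\<close>

lemma bounded_ops_cstar_subalgebra: "cstar_subalgebra \<Gamma> (bounded_ops \<Gamma>)"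
  unfolding cstar_subalgebra_def op_subspace_def norm_closed_def
  by (auto simp: zero_in_bounded_ops bounded_ops_plus bounded_ops_op_scale bounded_ops_comp
      op_adjoint_eq_adj_matrix adj_matrix_in_bounded_ops)


section \<open>Multiplication operators\<close>

lemma mult_op_in_bounded_ops:
  assumes "bounded (f ` \<Gamma>)"
  shows "mult_op \<Gamma> f \<in> bounded_ops \<Gamma>"
proof -
  from assms obtain K where K: "0 \<le> K" "\<And>g. g \<in> \<Gamma> \<Longrightarrow> cmod (f g) \<le> K"
    unfolding bounded_iff by (metis imageI norm_ge_zero order_trans linear)
  show ?thesis
  proof (rule bounded_opsI[where K = K])
    fix x assume x: "x \<in> ell2 \<Gamma>"
    show "mult_op \<Gamma> f x \<in> ell2 \<Gamma>"
      using ell2_bounded_mult[OF x K(2,1)] x by (simp add: mult_op_def)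
    show "ell2_norm \<Gamma> (mult_op \<Gamma> f x) \<le> K * ell2_norm \<Gamma> x"
      using ell2_norm_bounded_mult[OF x K(2,1)] x by (simp add: mult_op_def)
    show "mult_op \<Gamma> f (scale_fun c x) = scale_fun c (mult_op \<Gamma> f x)" for c
      using x by (auto simp: mult_op_def ell2_scale fun_eq_iff)
    show "mult_op \<Gamma> f (x + y) = mult_op \<Gamma> f x + mult_op \<Gamma> f y" if "y \<in> ell2 \<Gamma>" for y
      using x that by (auto simp: mult_op_def ell2_add fun_eq_iff distrib_left)
  qed (simp add: mult_op_def)
qed

text \<open>This is \<open>c e\<^sub>g\<close>, where \<open>e\<^sub>g\<close> is the projection onto the line spanned by the unit vector
  at \<open>g\<close>.\<close>

definition point_op :: "'a set \<Rightarrow> complex \<Rightarrow> 'a \<Rightarrow> 'a operator" where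
  "point_op \<Gamma> c g = mult_op \<Gamma> (scale_fun c (ell2_unit g))"

lemma point_op_in_ell_infty: "point_op \<Gamma> c g \<in> ell_infty \<Gamma>"
proof -
  have "bounded (scale_fun c (ell2_unit g) ` \<Gamma>)"
    unfolding bounded_iff by (intro exI[of _ "cmod c"]) auto
  then show ?thesis by (auto simp: point_op_def ell_infty_def)
qed

lemma ell_infty_subset_bounded_ops: "ell_infty \<Gamma> \<subseteq> bounded_ops \<Gamma>"
  unfolding ell_infty_def by (auto intro: mult_op_in_bounded_ops)

lemma point_op_apply:
  "x \<in> ell2 \<Gamma> \<Longrightarrow> point_op \<Gamma> c g x = scale_fun (c * x g) (ell2_unit g)"
  by (auto simp: point_op_def mult_op_def fun_eq_iff)

text \<open>For a nonzero matrix entry \<open>c\<close> of \<open>T\<close> at \<open>(h, g)\<close>, the corner \<open>V = e\<^sub>h T e\<^sub>g\<close> is \<open>c\<close> times a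
  matrix unit, so \<open>V\<^sup>* V = \<bar>c\<bar>\<^sup>2 e\<^sub>g\<close>; the left factor divides by \<open>\<bar>c\<bar>\<^sup>2\<close>.\<close>

lemma point_op_from_nonzero_entry:
  fixes \<Gamma> T g h
  defines "c \<equiv> T (ell2_unit g) h"
    and "V \<equiv> point_op \<Gamma> 1 h \<circ> T \<circ> point_op \<Gamma> 1 g"
  assumes T: "T \<in> bounded_ops \<Gamma>" and gh: "g \<in> \<Gamma>" "h \<in> \<Gamma>" and c: "c \<noteq> 0"
  shows "point_op \<Gamma> (1 / (cmod c)\<^sup>2) g \<circ> (op_adjoint \<Gamma> V \<circ> V) = point_op \<Gamma> 1 g"
proof
  fix x
  have P: "point_op \<Gamma> d k \<in> bounded_ops \<Gamma>" for d k
    by (rule subsetD[OF ell_infty_subset_bounded_ops point_op_in_ell_infty])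
  have V: "V \<in> bounded_ops \<Gamma>"
    unfolding V_def by (intro bounded_ops_comp P T)
  have adj: "op_adjoint \<Gamma> V \<in> bounded_ops \<Gamma>"
    using adj_matrix_in_bounded_ops[OF V] by (simp only: op_adjoint_eq_adj_matrix[OF V])
  show "(point_op \<Gamma> (1 / (cmod c)\<^sup>2) g \<circ> (op_adjoint \<Gamma> V \<circ> V)) x = point_op \<Gamma> 1 g x"
  proof (cases "x \<in> ell2 \<Gamma>")
    case x: True
    have V_apply: "V y = scale_fun (y g * c) (ell2_unit h)" if y: "y \<in> ell2 \<Gamma>" for y
    proof -
      have u: "ell2_unit g \<in> ell2 \<Gamma>" by (rule ell2_unit_in_ell2[OF gh(1)])
      have "T (point_op \<Gamma> 1 g y) = scale_fun (y g) (T (ell2_unit g))"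
        unfolding point_op_apply[OF y] using bounded_ops_scale[OF T u] by (simp only: mult_1)
      moreover have "point_op \<Gamma> 1 h (scale_fun (y g) (T (ell2_unit g)))
          = scale_fun (y g * c) (ell2_unit h)"
        unfolding point_op_apply[OF ell2_scale[OF bounded_ops_closed[OF T u]]]
        by (simp only: c_def scale_fun_apply mult_1)
      ultimately show ?thesis by (simp only: V_def comp_apply)
    qed
    have "(op_adjoint \<Gamma> V (V x)) g = ell2_inner \<Gamma> (V x) (V (ell2_unit g))"
      using gh bounded_ops_range[OF V]
      by (simp add: op_adjoint_eq_adj_matrix[OF V] adj_matrix_def)
    also have "\<dots> = x g * c * ell2_inner \<Gamma> (ell2_unit h) (scale_fun c (ell2_unit h))"
      unfolding V_apply[OF x] V_apply[OF ell2_unit_in_ell2[OF gh(1)]]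
      by (simp only: ell2_inner_scale_left ell2_unit_apply if_True mult_1 refl)
    also have "\<dots> = x g * (c * cnj c)"
      by (simp only: ell2_inner_unit_left[OF gh(2)]) simp
    also have "\<dots> = x g * (cmod c)\<^sup>2"
      by (simp only: complex_norm_square)
    finally have entry: "(op_adjoint \<Gamma> V (V x)) g = x g * (cmod c)\<^sup>2" .
    have "point_op \<Gamma> (1 / (cmod c)\<^sup>2) g (op_adjoint \<Gamma> V (V x)) = scale_fun (x g) (ell2_unit g)"
    proof -
      have "1 / (cmod c)\<^sup>2 * (x g * (cmod c)\<^sup>2) = x g" using c by simp
      then show ?thesis by (simp only: point_op_apply[OF bounded_ops_range[OF adj]] entry)
    qed
    then show ?thesis by (simp only: comp_apply point_op_apply[OF x] mult_1)
  next
    case False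
    have "V x = 0" by (rule bounded_ops_outside[OF V False])
    then show ?thesis
      by (simp only: comp_apply bounded_ops_zero[OF adj] bounded_ops_zero[OF P]
          bounded_ops_outside[OF P False])
  qed
qed


section \<open>The generated C*-algebra\<close>

lemma cstar_gen_simps [simp]:
  "carrier (cstar_gen \<Gamma> U) = \<Inter>{A. cstar_subalgebra \<Gamma> A \<and> U \<subseteq> A}"
  "S \<otimes>\<^bsub>cstar_gen \<Gamma> U\<^esub> T = S \<circ> T" "\<one>\<^bsub>cstar_gen \<Gamma> U\<^esub> = op_id \<Gamma>"
  "S \<oplus>\<^bsub>cstar_gen \<Gamma> U\<^esub> T = S + T" "\<zero>\<^bsub>cstar_gen \<Gamma> U\<^esub> = 0"
  "c \<odot>\<^bsub>cstar_gen \<Gamma> U\<^esub> T = op_scale c T" "star (cstar_gen \<Gamma> U) T = op_adjoint \<Gamma> T"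
  by (simp_all add: cstar_gen_def)

lemma cstar_gen_superset: "U \<subseteq> carrier (cstar_gen \<Gamma> U)"
  by auto

lemma carrier_cstar_gen_cstar_subalgebra:
  assumes "U \<subseteq> bounded_ops \<Gamma>"
  shows "cstar_subalgebra \<Gamma> (carrier (cstar_gen \<Gamma> U))"
proof -
  have "carrier (cstar_gen \<Gamma> U) \<subseteq> bounded_ops \<Gamma>"
    using bounded_ops_cstar_subalgebra assms by auto
  moreover have "op_subspace (carrier (cstar_gen \<Gamma> U))"
    unfolding op_subspace_def cstar_gen_simps by (auto simp: cstar_subalgebra_def op_subspace_def)
  moreover have "norm_closed \<Gamma> (carrier (cstar_gen \<Gamma> U))"
    unfolding norm_closed_def[of \<Gamma> "carrier _"]
  proof (intro allI impI, elim conjE)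
    fix S :: "nat \<Rightarrow> 'a operator" and T
    assume S: "\<forall>n. S n \<in> carrier (cstar_gen \<Gamma> U)" and T: "T \<in> bounded_ops \<Gamma>"
      and lim: "(\<lambda>n. op_norm \<Gamma> (S n - T)) \<longlonglongrightarrow> 0"
    have "T \<in> A" if A: "cstar_subalgebra \<Gamma> A" "U \<subseteq> A" for A
    proof -
      have "\<forall>n. S n \<in> A" using S A by auto
      then show ?thesis
        using A T lim unfolding cstar_subalgebra_def norm_closed_def by blast
    qed
    then show "T \<in> carrier (cstar_gen \<Gamma> U)" by simp
  qed
  ultimately show ?thesis
    unfolding cstar_subalgebra_def[of \<Gamma> "carrier _"] by (auto simp: cstar_subalgebra_def)
qed

lemma ring_cstar_gen:
  assumes U: "unital_operator_space \<Gamma> U"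
  shows "ring (cstar_gen \<Gamma> U)"
proof -
  let ?A = "cstar_gen \<Gamma> U"
  have A: "cstar_subalgebra \<Gamma> (carrier ?A)"
    using U by (intro carrier_cstar_gen_cstar_subalgebra) (simp add: unital_operator_space_def)
  have sub: "T \<in> bounded_ops \<Gamma>" if "T \<in> carrier ?A" for T
    using A that unfolding cstar_subalgebra_def by blast
  have zero: "0 \<in> carrier ?A" and add: "S + T \<in> carrier ?A" and scale: "op_scale c T \<in> carrier ?A"
    and comp: "S \<circ> T \<in> carrier ?A" if "S \<in> carrier ?A" "T \<in> carrier ?A" for S T c
    using A that unfolding cstar_subalgebra_def op_subspace_def by blast+
  have id: "op_id \<Gamma> \<in> carrier ?A"
    using U cstar_gen_superset unfolding unital_operator_space_def by blast
  have neg: "op_scale (- 1) T + T = 0" for T :: "'a operator"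
    by (simp add: fun_eq_iff op_scale_def)
  have unit: "op_id \<Gamma> \<circ> T = T" "T \<circ> op_id \<Gamma> = T" if "T \<in> bounded_ops \<Gamma>" for T
    using bounded_ops_range[OF that] bounded_ops_outside[OF that] bounded_ops_zero[OF that]
    by (auto simp: op_id_def)
  have distrib: "S \<circ> (T + T') = (S \<circ> T) + (S \<circ> T')"
    if "S \<in> bounded_ops \<Gamma>" "T \<in> bounded_ops \<Gamma>" "T' \<in> bounded_ops \<Gamma>" for S T T'
    using bounded_ops_add[OF that(1) bounded_ops_range[OF that(2)] bounded_ops_range[OF that(3)]]
    by (simp only: fun_eq_iff comp_apply plus_fun_apply simp_thms)
  have distrib': "(S + S') \<circ> T = (S \<circ> T) + (S' \<circ> T)" for S S' T :: "'a operator"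
    by (simp only: fun_eq_iff comp_apply plus_fun_apply simp_thms)
  show ?thesis
  proof (rule ringI)
    show "abelian_group ?A"
    proof (rule abelian_groupI)
      show "\<exists>S\<in>carrier ?A. S \<oplus>\<^bsub>?A\<^esub> T = \<zero>\<^bsub>?A\<^esub>" if "T \<in> carrier ?A" for T
        using scale[OF that that] neg unfolding cstar_gen_simps(4,5) by blast
    qed (use zero[OF id id] add in \<open>simp_all only: cstar_gen_simps(4,5) add_ac add_0 add_0_right\<close>)
    show "monoid ?A"
      by (rule monoidI)
        (use id comp sub unit in \<open>simp_all only: cstar_gen_simps(2,3) comp_assoc\<close>)
  qed (use sub distrib distrib' in \<open>simp_all only: cstar_gen_simps(2,4)\<close>)
qed


section \<open>The operator norm and matrix norms\<close>

lemma op_norm_bound_bdd: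
  assumes "T \<in> bounded_ops \<Gamma>"
  shows "bdd_above ((\<lambda>x. ell2_norm \<Gamma> (T x)) ` {x \<in> ell2 \<Gamma>. ell2_norm \<Gamma> x \<le> 1})"
proof -
  obtain K where K: "0 \<le> K" "\<And>x. x \<in> ell2 \<Gamma> \<Longrightarrow> ell2_norm \<Gamma> (T x) \<le> K * ell2_norm \<Gamma> x"
    using bounded_ops_bound assms by metis
  show ?thesis
  proof (rule bdd_aboveI2)
    fix x assume x: "x \<in> {x \<in> ell2 \<Gamma>. ell2_norm \<Gamma> x \<le> 1}"
    then have "ell2_norm \<Gamma> (T x) \<le> K * ell2_norm \<Gamma> x" using K by blast
    also have "\<dots> \<le> K * 1" using x K by (intro mult_left_mono) auto
    finally show "ell2_norm \<Gamma> (T x) \<le> K" by simp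
  qed
qed

lemma
  assumes "T \<in> bounded_ops \<Gamma>"
  shows ell2_norm_le_op_norm: "x \<in> ell2 \<Gamma> \<Longrightarrow> ell2_norm \<Gamma> x \<le> 1 \<Longrightarrow> ell2_norm \<Gamma> (T x) \<le> op_norm \<Gamma> T"
    and op_norm_nonneg: "0 \<le> op_norm \<Gamma> T"
proof -
  show le: "ell2_norm \<Gamma> (T x) \<le> op_norm \<Gamma> T" if "x \<in> ell2 \<Gamma>" "ell2_norm \<Gamma> x \<le> 1" for x
    unfolding op_norm_def using that by (intro cSUP_upper op_norm_bound_bdd assms) auto
  show "0 \<le> op_norm \<Gamma> T"
    using le[OF zero_in_ell2] ell2_norm_nonneg[of \<Gamma> "T 0"] by (simp only: ell2_norm_zero) linarith
qed

lemma op_norm_zero: "op_norm \<Gamma> 0 = 0"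
proof -
  have "{x \<in> ell2 \<Gamma>. ell2_norm \<Gamma> x \<le> 1} \<noteq> {}"
    using zero_in_ell2 ell2_norm_zero by (metis (mono_tags, lifting) empty_iff mem_Collect_eq zero_le_one)
  then show ?thesis by (simp add: op_norm_def)
qed

lemma mat_norm_one: "mat_norm \<Gamma> 1 M = op_norm \<Gamma> (M 0 0)"
proof -
  let ?B = "{x \<in> ell2 \<Gamma>. ell2_norm \<Gamma> x \<le> 1}"
  let ?C = "{x :: nat \<Rightarrow> 'a \<Rightarrow> complex. (\<forall>j<1. x j \<in> ell2 \<Gamma>) \<and> sqrt (\<Sum>j<1. (ell2_norm \<Gamma> (x j))\<^sup>2) \<le> 1}"
  have C: "?C = {x. x 0 \<in> ?B}" by auto
  have "(\<lambda>x. x 0) ` ?C = ?B"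
    unfolding C by (auto intro!: image_eqI[where x = "\<lambda>_. _"])
  then have "op_norm \<Gamma> (M 0 0) = Sup ((\<lambda>x. ell2_norm \<Gamma> (M 0 0 x)) ` (\<lambda>x. x 0) ` ?C)"
    by (simp only: op_norm_def)
  also have "\<dots> = mat_norm \<Gamma> 1 M"
    unfolding image_image mat_norm_def by simp
  finally show ?thesis by simp
qed

lemma mat_norm_cong:
  assumes "\<And>i j. i < n \<Longrightarrow> j < n \<Longrightarrow> M i j = N i j"
  shows "mat_norm \<Gamma> n M = mat_norm \<Gamma> n N"
proof -
  have "(\<Sum>j<n. M i j (x j)) = (\<Sum>j<n. N i j (x j))" if "i < n" for i x
    using that assms by (intro sum.cong) auto
  then show ?thesis unfolding mat_norm_def by simp
qed


section \<open>Boundary ideals\<close>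

lemma zero_coset: "{0} +>\<^bsub>cstar_gen \<Gamma> U\<^esub> T = {T}"
  by (simp add: a_r_coset_def')

text \<open>Cosets of the zero ideal are singletons, so each infimum in the quotient norm is over the
  representatives of a single matrix.\<close>

lemma boundary_ideal_zero:
  assumes U: "unital_operator_space \<Gamma> U"
  shows "boundary_ideal \<Gamma> U {0}"
  unfolding boundary_ideal_def
proof (intro conjI)
  let ?A = "cstar_gen \<Gamma> U"
  interpret ring ?A by (rule ring_cstar_gen[OF U])
  show "ideal {0} ?A" using zeroideal by (simp only: cstar_gen_simps(5))
  show "norm_closed \<Gamma> {0}"
    unfolding norm_closed_def
  proof (intro allI impI, elim conjE)
    fix S :: "nat \<Rightarrow> 'a operator" and T
    assume S: "\<forall>n. S n \<in> {0}" and T: "T \<in> bounded_ops \<Gamma>"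
      and lim: "(\<lambda>n. op_norm \<Gamma> (S n - T)) \<longlonglongrightarrow> 0"
    have neg: "- T = op_scale (- 1) T" by (simp add: fun_eq_iff op_scale_def)
    have "S n - T = op_scale (- 1) T" for n using S by (simp add: neg)
    then have norm: "op_norm \<Gamma> (op_scale (- 1) T) = 0"
      using lim by (simp add: LIMSEQ_const_iff)
    have bd: "op_scale (- 1) T \<in> bounded_ops \<Gamma>" by (rule bounded_ops_op_scale[OF T])
    have "op_scale (- 1) T = 0"
    proof (rule bounded_ops_eq_zero[OF bd])
      fix g assume g: "g \<in> \<Gamma>"
      have "ell2_norm \<Gamma> (op_scale (- 1) T (ell2_unit g)) \<le> 0"
        using ell2_norm_le_op_norm[OF bd ell2_unit_in_ell2[OF g]] norm ell2_norm_unit[OF g] by simp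
      then show "op_scale (- 1) T (ell2_unit g) = 0"
        by (intro ell2_norm_eq_zero[OF bounded_ops_range[OF bd]] antisym) auto
    qed
    then have "- T = 0" using neg by metis
    then show "T \<in> {0}" by (simp only: neg_equal_0_iff_equal singleton_iff)
  qed
  show "complete_isometry_on U (mat_norm \<Gamma>) (quot_mat_norm \<Gamma>) (\<lambda>T. {0} +>\<^bsub>?A\<^esub> T)"
    unfolding complete_isometry_on_def zero_coset
  proof (intro allI impI)
    fix n and M :: "nat \<Rightarrow> nat \<Rightarrow> 'a operator"
    let ?R = "{N. \<forall>i<n. \<forall>j<n. N i j \<in> {M i j}}"
    have "mat_norm \<Gamma> n ` ?R = {mat_norm \<Gamma> n M}"
      by (auto intro!: mat_norm_cong image_eqI[where x = M])
    then show "quot_mat_norm \<Gamma> n (\<lambda>i j. {M i j}) = mat_norm \<Gamma> n M"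
      by (simp only: quot_mat_norm_def cInf_singleton)
  qed
qed

text \<open>The projection \<open>e\<^sub>g\<close> has norm at least one, and an element of \<open>J\<close> has norm zero in the
  quotient. An isometry on \<open>U\<close> cannot send one to the other.\<close>

lemma boundary_ideal_avoids_point_op:
  assumes J: "boundary_ideal \<Gamma> U J" and U: "U \<subseteq> bounded_ops \<Gamma>"
    and P: "point_op \<Gamma> 1 g \<in> U" and g: "g \<in> \<Gamma>"
  shows "point_op \<Gamma> 1 g \<notin> J"
proof
  let ?A = "cstar_gen \<Gamma> U" and ?P = "point_op \<Gamma> 1 g"
  assume PJ: "?P \<in> J"
  interpret ideal J ?A using J by (simp add: boundary_ideal_def)
  have sub: "J \<subseteq> bounded_ops \<Gamma>"
    using a_subset carrier_cstar_gen_cstar_subalgebra[OF U] unfolding cstar_subalgebra_def by blast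
  have coset: "J +>\<^bsub>?A\<^esub> ?P = J" by (rule a_rcos_const[OF PJ])
  let ?R = "{M. \<forall>i<1. \<forall>j<1. M i j \<in> J}"
  have "quot_mat_norm \<Gamma> 1 (\<lambda>i j. J) = mat_norm \<Gamma> 1 (\<lambda>i j. ?P)"
  proof -
    have "complete_isometry_on U (mat_norm \<Gamma>) (quot_mat_norm \<Gamma>) (\<lambda>T. J +>\<^bsub>?A\<^esub> T)"
      using J unfolding boundary_ideal_def by blast
    then have "quot_mat_norm \<Gamma> 1 (\<lambda>i j. J +>\<^bsub>?A\<^esub> ?P) = mat_norm \<Gamma> 1 (\<lambda>i j. ?P)"
      unfolding complete_isometry_on_def using P
      by (elim allE[where x = 1] allE[where x = "\<lambda>_ _. ?P"]) blast
    then show ?thesis by (simp only: coset)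
  qed
  also have "\<dots> = op_norm \<Gamma> ?P" by (rule mat_norm_one)
  finally have "op_norm \<Gamma> ?P = (INF M\<in>?R. mat_norm \<Gamma> 1 M)" by (simp only: quot_mat_norm_def)
  \<comment> \<open>As \<open>e\<^sub>g \<in> J\<close>, its coset is \<open>J\<close> and has \<open>0\<close> as a representative.\<close>
  also have "\<dots> \<le> mat_norm \<Gamma> 1 (\<lambda>_ _. 0)"
  proof (rule cINF_lower)
    show "bdd_below (mat_norm \<Gamma> 1 ` ?R)"
      using sub by (intro bdd_belowI2[where m = 0]) (auto simp: mat_norm_one[unfolded One_nat_def] intro!: op_norm_nonneg)
    have "0 \<in> J"
      using additive_subgroup.zero_closed[OF is_additive_subgroup] by (simp only: cstar_gen_simps(5))
    then show "(\<lambda>_ _. 0) \<in> ?R" by blast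
  qed
  also have "\<dots> = 0" by (simp only: mat_norm_one op_norm_zero)
  finally have "op_norm \<Gamma> ?P \<le> 0" .
  moreover have "ell2_norm \<Gamma> (?P (ell2_unit g)) \<le> op_norm \<Gamma> ?P"
    using ell2_norm_le_op_norm[OF subsetD[OF U P] ell2_unit_in_ell2[OF g]] ell2_norm_unit[OF g]
    by linarith
  moreover have "?P (ell2_unit g) = ell2_unit g"
    by (subst point_op_apply) (auto simp: ell2_unit_in_ell2 g fun_eq_iff)
  ultimately show False using ell2_norm_unit[OF g] by simp
qed

text \<open>A nonzero operator in \<open>J\<close> has a nonzero matrix entry. Cutting it down to that entry by diagonal
  projections and multiplying by the adjoint stays in \<open>J\<close>, and yields a projection \<open>e\<^sub>g\<close>.\<close>

lemma boundary_ideal_trivial: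
  assumes U: "unital_operator_space \<Gamma> U" and masa: "ell_infty \<Gamma> \<subseteq> U"
    and J: "boundary_ideal \<Gamma> U J"
  shows "J \<subseteq> {0}"
proof
  fix T assume TJ: "T \<in> J"
  let ?A = "cstar_gen \<Gamma> U"
  have sub: "U \<subseteq> bounded_ops \<Gamma>" using U by (simp add: unital_operator_space_def)
  note A = carrier_cstar_gen_cstar_subalgebra[OF sub]
  interpret ideal J ?A using J by (simp add: boundary_ideal_def)
  have T: "T \<in> bounded_ops \<Gamma>"
    using A a_Hcarr[OF TJ] unfolding cstar_subalgebra_def by blast
  have PU: "point_op \<Gamma> c g \<in> U" for c g by (rule subsetD[OF masa point_op_in_ell_infty])
  then have P: "point_op \<Gamma> c g \<in> carrier ?A" for c g using cstar_gen_superset by blast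
  show "T \<in> {0}"
  proof (rule ccontr)
    assume "T \<notin> {0}"
    then have "T \<noteq> 0" by blast
    then obtain g where g: "g \<in> \<Gamma>" "T (ell2_unit g) \<noteq> 0"
      using bounded_ops_eq_zero[OF T] by blast
    then obtain h where c: "T (ell2_unit g) h \<noteq> 0" by (auto simp: fun_eq_iff)
    have h: "h \<in> \<Gamma>" using c bounded_ops_range[OF T, of "ell2_unit g"] by (auto simp: ell2_def)
    define V where "V = point_op \<Gamma> 1 h \<circ> T \<circ> point_op \<Gamma> 1 g"
    have "V \<in> J"
      using I_r_closed[OF I_l_closed[OF TJ P] P] by (simp only: V_def cstar_gen_simps(2))
    moreover have "op_adjoint \<Gamma> V \<in> carrier ?A"
      using A a_Hcarr[OF \<open>V \<in> J\<close>] unfolding cstar_subalgebra_def by blast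
    ultimately have "point_op \<Gamma> d g \<circ> (op_adjoint \<Gamma> V \<circ> V) \<in> J" for d
      using I_l_closed[OF I_l_closed P] by (simp only: cstar_gen_simps(2))
    then have "point_op \<Gamma> 1 g \<in> J"
      using point_op_from_nonzero_entry[OF T g(1) h c] unfolding V_def by metis
    with boundary_ideal_avoids_point_op[OF J sub PU g(1)] show False by blast
  qed
qed


section \<open>The quotient by the zero ideal\<close>

lemma star_isomorphic_quot_zero:
  assumes U: "unital_operator_space \<Gamma> U"
  shows "star_isomorphic (star_quot (cstar_gen \<Gamma> U) {0}) (cstar_gen \<Gamma> U)"
proof -
  let ?A = "cstar_gen \<Gamma> U"
  let ?Q = "star_quot ?A {0}"
  have carrier: "carrier ?Q = (\<lambda>T. {T}) ` carrier ?A"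
    by (simp only: star_quot_def FactRing_def A_RCOSETS_def' zero_coset partial_object.simps) auto
  have ops: "{S} \<otimes>\<^bsub>?Q\<^esub> {T} = {S \<circ> T}" "{S} \<oplus>\<^bsub>?Q\<^esub> {T} = {S + T}" "\<one>\<^bsub>?Q\<^esub> = {op_id \<Gamma>}"
    "c \<odot>\<^bsub>?Q\<^esub> {T} = {op_scale c T}" "star ?Q {T} = {op_adjoint \<Gamma> T}" for S T c
    by (simp_all add: star_quot_def FactRing_def rcoset_mult_def set_add_def' zero_coset
        del: cstar_gen_simps(1))
  have "the_elem \<in> ring_iso ?Q ?A"
    unfolding ring_iso_def ring_hom_def bij_betw_def inj_on_def carrier
    by (auto simp: ops image_image simp del: cstar_gen_simps(1))
  moreover have "\<forall>c. \<forall>X\<in>carrier ?Q. the_elem (c \<odot>\<^bsub>?Q\<^esub> X) = c \<odot>\<^bsub>?A\<^esub> the_elem X"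
    "\<forall>X\<in>carrier ?Q. the_elem (star ?Q X) = star ?A (the_elem X)"
    unfolding carrier by (auto simp: ops simp del: cstar_gen_simps(1))
  ultimately show ?thesis unfolding star_isomorphic_def by blast
qed


section \<open>The C*-envelope\<close>

theorem lemma2p11:
  fixes \<Gamma> :: "'a set" and U :: "'a operator set"
  assumes "unital_operator_space \<Gamma> U"
    and "ell_infty \<Gamma> \<subseteq> U"
  shows "star_isomorphic (cstar_envelope \<Gamma> U) (cstar_gen \<Gamma> U)"
proof -
  have "shilov_boundary \<Gamma> U = {0}"
    unfolding shilov_boundary_def
    by (rule Greatest_equality)
      (use boundary_ideal_zero[OF assms(1)] boundary_ideal_trivial[OF assms] in blast)+
  then show ?thesis
    using star_isomorphic_quot_zero[OF assms(1)] by (simp only: cstar_envelope_def)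
qed

end
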